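(* Let $(\Psi_u,\Psi_l,\mathcal S,\mathcal T,\epsilon)$ be a solution, for a fixed polynomial degree $d$, of the sum-of-squares program (SOS) described in the context, and let $\Psi^*$ be the exact solution of the linear Hamilton-Jacobi-Bellman PDE described in the context. Then the approximation error of the desirability function is bounded as $\|\Psi-\Psi^*\|_\infty\le\epsilon$, where $\Psi$ is either $\Psi_u$ or $\Psi_l$.
   Context: Setting. $\mathbb{R}[x]$ denotes real polynomials in $x\in\mathbb{R}^n$, $\mathbb{S}[x]$ the set of sums of squares of polynomials, and $\mathbb{R}_+=[0,\infty)$. $\Omega\subset\mathbb{R}^n$ is a compact basic closed semialgebraic set, $\Omega=\{x: g_i(x)\ge 0,\ i=1,\dots,k\}$ with $g_i\in\mathbb{R}[x]$, $0\in\Omega$; its boundary is $\partial\Omega=\{x:\prod_{i=1}^m h_i(x)=0\}$ with $h_i\in\mathbb{R}[x]$; the origin is treated as part of the boundary. $f,G,B$ are vector/matrix valued with entries in $\mathbb{R}[x]$ (drift, control matrix and noise matrix of the system $dx_t=(f(x_t)+G(x_t)u_t)dt+B(x_t)d\omega_t$, $\omega_t$ Brownian with covariance $\Sigma_\epsilon$), with $f(0)=0$, $G(0)=0$, $B(0)=0$. $R$ is a positive definite matrix, and $q,\phi\in\mathbb{R}[x]$ map $\Omega\to\mathbb{R}_+$ and are positive definite (zero at $0$, positive on $\Omega\setminus\{0\}$). It is assumed there is $\lambda>0$ with $\lambda G(x)R^{-1}G(x)^T=B(x)\Sigma_\epsilon B(x)^T=:\Sigma(x)$. The linear HJB PDE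 is $0=-\tfrac1\lambda q\Psi+\mathcal L(\Psi)$ on $\Omega$, $\Psi=\psi:=e^{-\phi/\lambda}$ on $\partial\Omega$, where $\mathcal L(\Psi)=f^T(\nabla_x\Psi)+\tfrac12\mathrm{Tr}((\nabla_{xx}\Psi)\Sigma)$. It is assumed that it has a unique viscosity solution $\Psi^*$. Norm: $\|F\|_\infty=\sup_{x\in\Omega}|F(x)|$. Operators. For a set $\Omega'=\{x:g_1\ge0,\dots,g_{k'}\ge0\}$ and $\mathcal S'=\{s_\nu\in\mathbb{S}[x]:\nu\in\{0,1\}^{k'}\}$, let $\mathcal D(\Omega',\mathcal S')=\sum_{\nu\in\{0,1\}^{k'}}s_\nu\,g_1^{\nu_1}\cdots g_{k'}^{\nu_{k'}}$. For $\mathcal T'=\{t_i\in\mathbb{R}[x]:i=1,\dots,m\}$, let $\mathcal B(p,\partial\Omega,\mathcal T')=\{p-t_ih_i: i=1,\dots,m\}$; writing $\mathcal B(\cdot)\in\mathbb{S}[x]$ means each of its elements is in $\mathbb{S}[x]$. In the boundary constraints $\psi$ is understood as a polynomial expression representing $e^{-\phi/\lambda}$ on $\partial\Omega$. Program (SOS): minimize $\epsilon$ over $\Psi_l,\Psi_u\in\mathbb{R}[x]$, $\mathcal S=(\mathcal S_1,\dots,\mathcal S_5)$ (families in $\mathbb{S}[x]$), $\mathcal T=(\mathcal T_1,\mathcal T_2,\mathcal T_3)$ (families in $\mathbb{R}[x]$), all polynomials of degree at most $d$, subject to - $-\tfrac1\lambda q\Psi_l+\mathcal L(\Psi_l)-\mathcal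 D(\Omega,\mathcal S_1)\in\mathbb{S}[x]$; - $\tfrac1\lambda q\Psi_u-\mathcal L(\Psi_u)-\mathcal D(\Omega,\mathcal S_2)\in\mathbb{S}[x]$; - $\epsilon-(\Psi_u-\Psi_l)-\mathcal D(\Omega,\mathcal S_3)\in\mathbb{S}[x]$; - $\mathcal B(\Psi_l,\partial\Omega,\mathcal T_1)\in\mathbb{S}[x]$, $\mathcal B(\psi-\Psi_l,\partial\Omega,\mathcal T_2)\in\mathbb{S}[x]$, $\mathcal B(\Psi_u-\psi,\partial\Omega,\mathcal T_3)\in\mathbb{S}[x]$; - for each coordinate $i$: $-\partial_{x^i}\Psi_l-\mathcal D(\Omega\cap\{x^i\ge0\},\mathcal S_4)\in\mathbb{S}[x]$ and $\partial_{x^i}\Psi_l-\mathcal D(\Omega\cap\{-x^i\ge0\},\mathcal S_5)\in\mathbb{S}[x]$; - $\Psi_l(0)=1$. *)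

theory Defs
  imports "HOL-Analysis.Analysis"
begin

text \<open>
  Real polynomials in \<open>n\<close> variables are represented by the functions they induce on
  \<open>real ^ 'n\<close>; over the reals this identification is injective. Membership in the
  polynomial ring is the library predicate \<open>real_polynomial_function\<close>; the total degree
  is read off a representation in monomials.
\<close>

definition poly_deg_le :: "nat \<Rightarrow> (real ^ 'n \<Rightarrow> real) \<Rightarrow> bool" where
  "poly_deg_le d p \<longleftrightarrow>
     (\<exists>c :: ('n \<Rightarrow> nat) \<Rightarrow> real.
        p = (\<lambda>x. \<Sum>\<alpha> | (\<Sum>i\<in>UNIV. \<alpha> i) \<le> d. c \<alpha> * (\<Prod>i\<in>UNIV. x $ i ^ \<alpha> i)))"

lemma finite_multi_indices: "finite {\<alpha> :: 'n::finite \<Rightarrow> nat. (\<Sum>i\<in>UNIV. \<alpha> i) \<le> d}"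
proof (rule finite_subset)
  show "{\<alpha> :: 'n \<Rightarrow> nat. (\<Sum>i\<in>UNIV. \<alpha> i) \<le> d} \<subseteq> (UNIV :: 'n set) \<rightarrow>\<^sub>E {..d}"
  proof
    fix \<alpha> :: "'n \<Rightarrow> nat"
    assume "\<alpha> \<in> {\<alpha>. (\<Sum>i\<in>UNIV. \<alpha> i) \<le> d}"
    then have "\<alpha> j \<le> d" for j
      using member_le_sum[of j UNIV \<alpha>] by simp
    then show "\<alpha> \<in> UNIV \<rightarrow>\<^sub>E {..d}"
      by (simp add: PiE_UNIV_domain)
  qed
qed (simp add: finite_PiE)

lemma poly_deg_le_imp_polynomial:
  assumes "poly_deg_le d p"
  shows "real_polynomial_function p"
proof -
  have "real_polynomial_function (\<lambda>x :: real ^ 'n. x $ i)" for i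
    by (intro real_polynomial_function.intros(1) bounded_linear_vec_nth)
  then show ?thesis
    using assms unfolding poly_deg_le_def
    by (auto intro!: real_polynomial_function_sum real_polynomial_function_prod
        real_polynomial_function_power real_polynomial_function.intros(4)
        real_polynomial_function.intros(2) finite_multi_indices)
qed

definition sos :: "(real ^ 'n \<Rightarrow> real) \<Rightarrow> bool" where
  "sos p \<longleftrightarrow>
     (\<exists>ps. (\<forall>r\<in>set ps. real_polynomial_function r) \<and> p = (\<lambda>x. \<Sum>r\<leftarrow>ps. (r x)\<^sup>2))"

definition basic_semialgebraic :: "nat \<Rightarrow> (nat \<Rightarrow> real ^ 'n \<Rightarrow> real) \<Rightarrow> (real ^ 'n) set" where
  "basic_semialgebraic k g = {x. \<forall>i\<in>{1..k}. g i x \<ge> 0}"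

text \<open>The equation degenerates at the origin, where the solution is prescribed as on the frontier.\<close>

definition boundary0 :: "(real ^ 'n) set \<Rightarrow> (real ^ 'n) set" where
  "boundary0 \<Omega> = insert 0 (frontier \<Omega>)"

definition pos_def_on :: "(real ^ 'n) set \<Rightarrow> (real ^ 'n \<Rightarrow> real) \<Rightarrow> bool" where
  "pos_def_on \<Omega> p \<longleftrightarrow> p 0 = 0 \<and> (\<forall>x\<in>\<Omega> - {0}. p x > 0)"

definition pos_def_matrix :: "real ^ 'n ^ 'n \<Rightarrow> bool" where
  "pos_def_matrix M \<longleftrightarrow> transpose M = M \<and> (\<forall>v. v \<noteq> 0 \<longrightarrow> v \<bullet> (M *v v) > 0)"

definition pos_semidef_matrix :: "real ^ 'n ^ 'n \<Rightarrow> bool" where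
  "pos_semidef_matrix M \<longleftrightarrow> transpose M = M \<and> (\<forall>v. v \<bullet> (M *v v) \<ge> 0)"

definition sup_norm_on :: "(real ^ 'n) set \<Rightarrow> (real ^ 'n \<Rightarrow> real) \<Rightarrow> real" where
  "sup_norm_on \<Omega> F = (SUP x\<in>\<Omega>. \<bar>F x\<bar>)"

definition partial_deriv :: "'n \<Rightarrow> (real ^ 'n \<Rightarrow> real) \<Rightarrow> real ^ 'n \<Rightarrow> real" where
  "partial_deriv i F x = frechet_derivative F (at x) (axis i 1)"

definition grad :: "(real ^ 'n \<Rightarrow> real) \<Rightarrow> real ^ 'n \<Rightarrow> real ^ 'n" where
  "grad F x = (\<chi> i. partial_deriv i F x)"

definition hess :: "(real ^ 'n \<Rightarrow> real) \<Rightarrow> real ^ 'n \<Rightarrow> real ^ 'n ^ 'n" where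
  "hess F x = (\<chi> i j. partial_deriv i (partial_deriv j F) x)"

text \<open>Twice continuous differentiability, meant for open \<open>U\<close>.\<close>

definition C2_on :: "(real ^ 'n) set \<Rightarrow> (real ^ 'n \<Rightarrow> real) \<Rightarrow> bool" where
  "C2_on U F \<longleftrightarrow>
     (\<forall>x\<in>U. F differentiable (at x)) \<and>
     (\<forall>i. \<forall>x\<in>U. partial_deriv i F differentiable (at x)) \<and>
     (\<forall>i j. continuous_on U (partial_deriv i (partial_deriv j F)))"

text \<open>
  Viscosity solutions in the sense of Crandall, Ishii and Lions of an equation
  \<open>F(x, u, Du, D\<^sup>2u) = 0\<close>, where \<open>F\<close> is degenerate elliptic, i.e. nonincreasing in the
  Hessian argument. The Dirichlet condition is imposed pointwise.
\<close>

type_synonym 'n pde = "real ^ 'n \<Rightarrow> real \<Rightarrow> real ^ 'n \<Rightarrow> real ^ 'n ^ 'n \<Rightarrow> real"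

definition viscosity_sub :: "('n::finite) pde \<Rightarrow> (real ^ 'n) set \<Rightarrow> (real ^ 'n \<Rightarrow> real) \<Rightarrow> bool" where
  "viscosity_sub F U u \<longleftrightarrow>
     (\<forall>\<theta> x. C2_on U \<theta> \<longrightarrow> x \<in> U \<longrightarrow>
        (\<forall>\<^sub>F y in at x within U. u y - \<theta> y \<le> u x - \<theta> x) \<longrightarrow>
        F x (u x) (grad \<theta> x) (hess \<theta> x) \<le> 0)"

definition viscosity_super :: "('n::finite) pde \<Rightarrow> (real ^ 'n) set \<Rightarrow> (real ^ 'n \<Rightarrow> real) \<Rightarrow> bool" where
  "viscosity_super F U u \<longleftrightarrow>
     (\<forall>\<theta> x. C2_on U \<theta> \<longrightarrow> x \<in> U \<longrightarrow>
        (\<forall>\<^sub>F y in at x within U. u y - \<theta> y \<ge> u x - \<theta> x) \<longrightarrow>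
        F x (u x) (grad \<theta> x) (hess \<theta> x) \<ge> 0)"

definition viscosity_dirichlet ::
  "('n::finite) pde \<Rightarrow> (real ^ 'n) set \<Rightarrow> (real ^ 'n) set \<Rightarrow> (real ^ 'n \<Rightarrow> real) \<Rightarrow> (real ^ 'n \<Rightarrow> real) \<Rightarrow> bool"
  where
  "viscosity_dirichlet F \<Omega> bd b u \<longleftrightarrow>
     continuous_on \<Omega> u \<and>
     viscosity_sub F (\<Omega> - bd) u \<and> viscosity_super F (\<Omega> - bd) u \<and>
     (\<forall>x\<in>bd. u x = b x)"

definition hjb_L :: "(real ^ 'n \<Rightarrow> real ^ 'n) \<Rightarrow> (real ^ 'n \<Rightarrow> real ^ 'n ^ 'n) \<Rightarrow>
    (real ^ 'n \<Rightarrow> real) \<Rightarrow> real ^ 'n \<Rightarrow> real" where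
  "hjb_L f \<Sigma> \<Psi> x = f x \<bullet> grad \<Psi> x + 1/2 * trace (hess \<Psi> x ** \<Sigma> x)"

text \<open>
  The equation \<open>0 = - q \<Psi> / lam + L \<Psi>\<close> with the sign that makes it degenerate elliptic and
  nondecreasing in \<open>\<Psi>\<close>.
\<close>

definition hjb_pde :: "real \<Rightarrow> (real ^ 'n \<Rightarrow> real) \<Rightarrow> (real ^ 'n \<Rightarrow> real ^ 'n) \<Rightarrow>
    (real ^ 'n \<Rightarrow> real ^ 'n ^ 'n) \<Rightarrow> ('n::finite) pde" where
  "hjb_pde lam q f \<Sigma> x r p X =
     - (- (1/lam) * q x * r + (f x \<bullet> p + 1/2 * trace (X ** \<Sigma> x)))"

text \<open>A family indexed by \<open>{0,1}\<^sup>k\<close> is a function on the extensional functions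
  \<open>{1..k} \<rightarrow>\<^sub>E {0,1}\<close>; its values elsewhere are irrelevant.\<close>

type_synonym 'n family = "(nat \<Rightarrow> nat) \<Rightarrow> real ^ 'n \<Rightarrow> real"

definition cube :: "nat \<Rightarrow> (nat \<Rightarrow> nat) set" where
  "cube k = ({1..k} \<rightarrow>\<^sub>E {0, 1})"

definition D_op :: "nat \<Rightarrow> (nat \<Rightarrow> real ^ 'n \<Rightarrow> real) \<Rightarrow> ('n::finite) family \<Rightarrow> real ^ 'n \<Rightarrow> real" where
  "D_op k g s x = (\<Sum>\<nu>\<in>cube k. s \<nu> x * (\<Prod>i=1..k. g i x ^ \<nu> i))"

definition B_sos :: "nat \<Rightarrow> (nat \<Rightarrow> real ^ 'n \<Rightarrow> real) \<Rightarrow> (real ^ 'n \<Rightarrow> real) \<Rightarrow>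
    (nat \<Rightarrow> real ^ 'n \<Rightarrow> real) \<Rightarrow> bool" where
  "B_sos m h p t \<longleftrightarrow> (\<forall>i\<in>{1..m}. sos (\<lambda>x. p x - t i x * h i x))"

definition sos_family :: "nat \<Rightarrow> nat \<Rightarrow> ('n::finite) family \<Rightarrow> bool" where
  "sos_family d k s \<longleftrightarrow> (\<forall>\<nu>\<in>cube k. sos (s \<nu>) \<and> poly_deg_le d (s \<nu>))"

definition poly_family :: "nat \<Rightarrow> nat \<Rightarrow> (nat \<Rightarrow> real ^ 'n \<Rightarrow> real) \<Rightarrow> bool" where
  "poly_family d m t \<longleftrightarrow> (\<forall>i\<in>{1..m}. poly_deg_le d (t i))"

record ('n::finite) sos_vars =
  Psi_l :: "real ^ 'n \<Rightarrow> real"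
  Psi_u :: "real ^ 'n \<Rightarrow> real"
  S1 :: "('n::finite) family"
  S2 :: "('n::finite) family"
  S3 :: "('n::finite) family"
  S4 :: "('n::finite) family"
  S5 :: "('n::finite) family"
  T1 :: "nat \<Rightarrow> real ^ 'n \<Rightarrow> real"
  T2 :: "nat \<Rightarrow> real ^ 'n \<Rightarrow> real"
  T3 :: "nat \<Rightarrow> real ^ 'n \<Rightarrow> real"
  eps :: real

text \<open>
  Intersecting \<open>\<Omega>\<close> with a half space appends a constraint number \<open>k + 1\<close>, so \<open>S4\<close> and
  \<open>S5\<close> are indexed by \<open>{0,1}\<close> to the power \<open>k + 1\<close>. They are shared by all coordinates.
\<close>

definition sos_feasible ::
  "nat \<Rightarrow> (nat \<Rightarrow> real ^ 'n \<Rightarrow> real) \<Rightarrow> nat \<Rightarrow> (nat \<Rightarrow> real ^ 'n \<Rightarrow> real) \<Rightarrow>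
   real \<Rightarrow> (real ^ 'n \<Rightarrow> real) \<Rightarrow> (real ^ 'n \<Rightarrow> real ^ 'n) \<Rightarrow> (real ^ 'n \<Rightarrow> real ^ 'n ^ 'n) \<Rightarrow>
   (real ^ 'n \<Rightarrow> real) \<Rightarrow> nat \<Rightarrow> ('n::finite) sos_vars \<Rightarrow> bool" where
  "sos_feasible k g m h lam q f \<Sigma> \<psi> d z \<longleftrightarrow>
     poly_deg_le d (Psi_l z) \<and> poly_deg_le d (Psi_u z) \<and>
     sos_family d k (S1 z) \<and> sos_family d k (S2 z) \<and> sos_family d k (S3 z) \<and>
     sos_family d (k + 1) (S4 z) \<and> sos_family d (k + 1) (S5 z) \<and>
     poly_family d m (T1 z) \<and> poly_family d m (T2 z) \<and> poly_family d m (T3 z) \<and>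
     sos (\<lambda>x. - (1/lam) * q x * Psi_l z x + hjb_L f \<Sigma> (Psi_l z) x - D_op k g (S1 z) x) \<and>
     sos (\<lambda>x. (1/lam) * q x * Psi_u z x - hjb_L f \<Sigma> (Psi_u z) x - D_op k g (S2 z) x) \<and>
     sos (\<lambda>x. eps z - (Psi_u z x - Psi_l z x) - D_op k g (S3 z) x) \<and>
     B_sos m h (Psi_l z) (T1 z) \<and>
     B_sos m h (\<lambda>x. \<psi> x - Psi_l z x) (T2 z) \<and>
     B_sos m h (\<lambda>x. Psi_u z x - \<psi> x) (T3 z) \<and>
     (\<forall>i. sos (\<lambda>x. - partial_deriv i (Psi_l z) x
                   - D_op (k + 1) (g(k + 1 := (\<lambda>x. x $ i))) (S4 z) x) \<and>
          sos (\<lambda>x. partial_deriv i (Psi_l z) x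
                   - D_op (k + 1) (g(k + 1 := (\<lambda>x. - (x $ i)))) (S5 z) x)) \<and>
     Psi_l z 0 = 1"

definition sos_solution ::
  "nat \<Rightarrow> (nat \<Rightarrow> real ^ 'n \<Rightarrow> real) \<Rightarrow> nat \<Rightarrow> (nat \<Rightarrow> real ^ 'n \<Rightarrow> real) \<Rightarrow>
   real \<Rightarrow> (real ^ 'n \<Rightarrow> real) \<Rightarrow> (real ^ 'n \<Rightarrow> real ^ 'n) \<Rightarrow> (real ^ 'n \<Rightarrow> real ^ 'n ^ 'n) \<Rightarrow>
   (real ^ 'n \<Rightarrow> real) \<Rightarrow> nat \<Rightarrow> ('n::finite) sos_vars \<Rightarrow> bool" where
  "sos_solution k g m h lam q f \<Sigma> \<psi> d z \<longleftrightarrow>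
     sos_feasible k g m h lam q f \<Sigma> \<psi> d z \<and>
     (\<forall>z'. sos_feasible k g m h lam q f \<Sigma> \<psi> d z' \<longrightarrow> eps z \<le> eps z')"

end

theory Submission
  imports Defs
begin

text \<open>
  The polynomial \<open>\<Psi>\<^sub>l\<close> is a classical subsolution and \<open>\<Psi>\<^sub>u\<close> a classical supersolution of the
  Hamilton-Jacobi-Bellman equation. Each may itself serve as the test function for the viscosity
  solution \<open>\<Psi>\<^sup>*\<close>: at an extremum of the difference away from the boundary, the viscosity inequality
  and the classical one combine to \<open>q (\<Psi>\<^sup>* - \<Psi>\<^sub>l) \<ge> 0\<close>, and \<open>q > 0\<close> there. Hence
  \<open>\<Psi>\<^sub>l \<le> \<Psi>\<^sup>* \<le> \<Psi>\<^sub>u\<close>, while \<open>\<Psi>\<^sub>u - \<Psi>\<^sub>l \<le> \<epsilon>\<close> is one of the constraints.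
\<close>

lemma partial_deriv_eqI:
  assumes "(F has_derivative F') (at x)"
  shows "partial_deriv i F x = F' (axis i 1)"
  using frechet_derivative_at[OF assms] by (simp add: partial_deriv_def)

text \<open>Structural induction on polynomials. Both claims are carried through the induction
  together: the sum and product rules need the components to be differentiable, and the product rule
  yields a polynomial again only if the partial derivatives of the factors are polynomials.\<close>

lemma real_polynomial_function_partial_deriv:
  fixes p :: "real ^ 'n \<Rightarrow> real"
  assumes "real_polynomial_function p"
  shows "p differentiable (at x)" and "real_polynomial_function (partial_deriv i p)"
proof -
  have "(\<forall>x. p differentiable (at x)) \<and> real_polynomial_function (partial_deriv i p)"
    using assms
  proof (induction rule: real_polynomial_function.induct)
    case (linear p)
    then have D: "(p has_derivative p) (at x)" for x
      by (rule bounded_linear_imp_has_derivative)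
    \<comment> \<open>A bounded linear map is its own derivative at every point, so its partial
      derivatives are constant.\<close>
    then have "partial_deriv i p = (\<lambda>_. p (axis i 1))"
      by (intro ext partial_deriv_eqI)
    with differentiableI[OF D] show ?case
      by (simp add: real_polynomial_function.intros(2))
  next
    case (const c)
    have "partial_deriv i (\<lambda>x. c) = (\<lambda>x. 0)"
      by (simp add: partial_deriv_def fun_eq_iff)
    then show ?case
      by (simp add: real_polynomial_function.intros(2))
  next
    case (add p q)
    then have "(p has_derivative frechet_derivative p (at x)) (at x)"
      and "(q has_derivative frechet_derivative q (at x)) (at x)" for x
      by (simp_all flip: frechet_derivative_works)
    from has_derivative_add[OF this]
    have D: "((\<lambda>x. p x + q x) has_derivative
        (\<lambda>v. frechet_derivative p (at x) v + frechet_derivative q (at x) v)) (at x)" for x .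
    have "partial_deriv i (\<lambda>x. p x + q x) = (\<lambda>x. partial_deriv i p x + partial_deriv i q x)"
      by (simp add: fun_eq_iff partial_deriv_eqI[OF D])
        (simp add: partial_deriv_def)
    moreover have "\<forall>x. (\<lambda>x. p x + q x) differentiable (at x)"
      using differentiableI[OF D] by blast
    ultimately show ?case
      using add.IH by (simp add: real_polynomial_function.intros(3))
  next
    case (mult p q)
    then have "(p has_derivative frechet_derivative p (at x)) (at x)"
      and "(q has_derivative frechet_derivative q (at x)) (at x)" for x
      by (simp_all flip: frechet_derivative_works)
    from has_derivative_mult[OF this]
    have D: "((\<lambda>x. p x * q x) has_derivative
        (\<lambda>v. p x * frechet_derivative q (at x) v + frechet_derivative p (at x) v * q x)) (at x)" for x .
    have "partial_deriv i (\<lambda>x. p x * q x) =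
        (\<lambda>x. p x * partial_deriv i q x + partial_deriv i p x * q x)"
      by (simp add: fun_eq_iff partial_deriv_eqI[OF D]) (simp add: partial_deriv_def)
    moreover have "real_polynomial_function (\<lambda>x. p x * partial_deriv i q x + partial_deriv i p x * q x)"
      using mult by (intro real_polynomial_function.intros(3,4)) auto
    moreover have "\<forall>x. (\<lambda>x. p x * q x) differentiable (at x)"
      using differentiableI[OF D] by blast
    ultimately show ?case
      by simp
  qed
  then show "p differentiable (at x)" and "real_polynomial_function (partial_deriv i p)"
    by auto
qed

lemma continuous_on_real_polynomial_function:
  fixes p :: "real ^ 'n \<Rightarrow> real"
  assumes "real_polynomial_function p"
  shows "continuous_on U p"
  using assms by (simp add: continuous_on_polymonial_function real_polynomial_function_eq)

text \<open>Closure under \<open>partial_deriv\<close> can be iterated, so derivatives of every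
  order are again polynomials. This makes \<open>Psi_l\<close> and \<open>Psi_u\<close> admissible
  as test functions.\<close>

lemma C2_on_real_polynomial_function:
  assumes "real_polynomial_function p"
  shows "C2_on U p"
  using assms unfolding C2_on_def
  by (simp add: real_polynomial_function_partial_deriv continuous_on_real_polynomial_function)

lemma sos_nonneg:
  assumes "sos p"
  shows "p x \<ge> 0"
  using assms unfolding sos_def by (auto intro!: sum_list_nonneg)

text \<open>Each summand is a square sum times powers of constraints that are nonnegative on the
  set. Thus \<open>sos\<close> of a difference \<open>p - D_op\<close> certifies nonnegativity of
  \<open>p\<close> on the set: the easy direction of a Positivstellensatz.\<close>

lemma D_op_nonneg:
  assumes "sos_family d k s" and "x \<in> basic_semialgebraic k g"
  shows "D_op k g s x \<ge> 0"
  using assms unfolding D_op_def sos_family_def basic_semialgebraic_def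
  by (intro sum_nonneg mult_nonneg_nonneg prod_nonneg) (auto intro: sos_nonneg)

text \<open>At a zero of the product some factor \<open>h i\<close> vanishes, and there the
  multiplier \<open>t i\<close> drops out of the \<open>i\<close>-th certificate. Which factor
  vanishes varies with the point, hence one certificate for each \<open>i\<close>.\<close>

lemma B_sos_nonneg:
  assumes "B_sos m h p t" and "(\<Prod>i=1..m. h i x) = 0"
  shows "p x \<ge> 0"
proof -
  obtain i where i: "i \<in> {1..m}" "h i x = 0"
    using assms(2) by (auto simp: prod_zero_iff)
  then have "p x - t i x * h i x \<ge> 0"
    using assms(1) sos_nonneg[of "\<lambda>x. p x - t i x * h i x" x] by (auto simp: B_sos_def)
  then show ?thesis
    using i by simp
qed

text \<open>The value \<open>r\<close> stays separate from \<open>v\<close> because a viscosity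
  inequality pairs the value of the solution with the derivatives of the test function.\<close>

lemma hjb_pde_classical:
  "hjb_pde lam q f \<Sigma> x r (grad v x) (hess v x) = (1/lam) * q x * r - hjb_L f \<Sigma> v x"
  by (simp add: hjb_pde_def hjb_L_def)

lemma viscosity_super_comparison:
  fixes u v :: "real ^ 'n \<Rightarrow> real"
  assumes "compact \<Omega>" and "continuous_on \<Omega> u" and "continuous_on \<Omega> v"
    and "C2_on (\<Omega> - bd) v" and "viscosity_super (hjb_pde lam q f \<Sigma>) (\<Omega> - bd) u"
    and "lam > 0" and q: "\<And>x. x \<in> \<Omega> - bd \<Longrightarrow> q x > 0"
    and sub: "\<And>x. x \<in> \<Omega> - bd \<Longrightarrow> (1/lam) * q x * v x - hjb_L f \<Sigma> v x \<le> 0"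
    and bd: "\<And>x. x \<in> \<Omega> \<inter> bd \<Longrightarrow> v x \<le> u x"
    and "x \<in> \<Omega>"
  shows "v x \<le> u x"
proof -
  \<comment> \<open>A global minimizer of \<open>u - v\<close> is the worst point for the claim, so
    it suffices to compare \<open>u\<close> and \<open>v\<close> there.\<close>
  obtain y where y: "y \<in> \<Omega>" "\<And>w. w \<in> \<Omega> \<Longrightarrow> u y - v y \<le> u w - v w"
    using continuous_attains_inf[of \<Omega> "\<lambda>x. u x - v x"] assms(1-3) \<open>x \<in> \<Omega>\<close>
    by (auto intro: continuous_on_diff)
  have "v y \<le> u y"
  proof (cases "y \<in> bd")
    case False
    \<comment> \<open>Minimality over all of \<open>\<Omega>\<close> is stronger than the local,
      relative minimality in \<open>viscosity_super\<close>; the test function is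
      \<open>v\<close>.\<close>
    have "\<forall>\<^sub>F w in at y within (\<Omega> - bd). u w - v w \<ge> u y - v y"
      using y by (auto simp: eventually_at_filter)
    then have "(1/lam) * q y * u y - hjb_L f \<Sigma> v y \<ge> 0"
      using assms(4,5) y False
      unfolding viscosity_super_def hjb_pde_classical[symmetric] by blast
    \<comment> \<open>Both inequalities contain the same term \<open>hjb_L f \<Sigma> v y\<close>.
      It cancels, leaving only the zeroth-order terms, whose coefficient is positive.\<close>
    then have "(1/lam * q y) * v y \<le> (1/lam * q y) * u y"
      using sub[of y] y False by simp
    moreover have "1/lam * q y > 0"
      using q[of y] \<open>lam > 0\<close> y False by simp
    ultimately show ?thesis
      by (simp only: mult_le_cancel_left_pos)
  qed (use bd y in auto)
  then show ?thesis
    using y(2)[OF \<open>x \<in> \<Omega>\<close>] by simp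
qed

text \<open>The mirror image of the previous comparison, with a maximizer of \<open>u - v\<close>
  and all inequalities reversed.\<close>

lemma viscosity_sub_comparison:
  fixes u v :: "real ^ 'n \<Rightarrow> real"
  assumes "compact \<Omega>" and "continuous_on \<Omega> u" and "continuous_on \<Omega> v"
    and "C2_on (\<Omega> - bd) v" and "viscosity_sub (hjb_pde lam q f \<Sigma>) (\<Omega> - bd) u"
    and "lam > 0" and q: "\<And>x. x \<in> \<Omega> - bd \<Longrightarrow> q x > 0"
    and super: "\<And>x. x \<in> \<Omega> - bd \<Longrightarrow> (1/lam) * q x * v x - hjb_L f \<Sigma> v x \<ge> 0"
    and bd: "\<And>x. x \<in> \<Omega> \<inter> bd \<Longrightarrow> u x \<le> v x"
    and "x \<in> \<Omega>"
  shows "u x \<le> v x"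
proof -
  obtain y where y: "y \<in> \<Omega>" "\<And>w. w \<in> \<Omega> \<Longrightarrow> u w - v w \<le> u y - v y"
    using continuous_attains_sup[of \<Omega> "\<lambda>x. u x - v x"] assms(1-3) \<open>x \<in> \<Omega>\<close>
    by (auto intro: continuous_on_diff)
  have "u y \<le> v y"
  proof (cases "y \<in> bd")
    case False
    have "\<forall>\<^sub>F w in at y within (\<Omega> - bd). u w - v w \<le> u y - v y"
      using y by (auto simp: eventually_at_filter)
    then have "(1/lam) * q y * u y - hjb_L f \<Sigma> v y \<le> 0"
      using assms(4,5) y False
      unfolding viscosity_sub_def hjb_pde_classical[symmetric] by blast
    then have "(1/lam * q y) * u y \<le> (1/lam * q y) * v y"
      using super[of y] y False by simp
    moreover have "1/lam * q y > 0"
      using q[of y] \<open>lam > 0\<close> y False by simp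
    ultimately show ?thesis
      by (simp only: mult_le_cancel_left_pos)
  qed (use bd y in auto)
  then show ?thesis
    using y(2)[OF \<open>x \<in> \<Omega>\<close>] by simp
qed

theorem proposition16:
  fixes k m d :: nat
    and g h :: "nat \<Rightarrow> real ^ 'n \<Rightarrow> real"
    and \<Omega> :: "(real ^ 'n) set"
    and f :: "real ^ 'n \<Rightarrow> real ^ 'n"
    and G :: "real ^ 'n \<Rightarrow> real ^ 'u ^ 'n"
    and B :: "real ^ 'n \<Rightarrow> real ^ 'w ^ 'n"
    and R :: "real ^ 'u ^ 'u"
    and \<Sigma>\<epsilon> :: "real ^ 'w ^ 'w"
    and \<Sigma> :: "real ^ 'n \<Rightarrow> real ^ 'n ^ 'n"
    and q \<phi> \<psi> \<Psi>star :: "real ^ 'n \<Rightarrow> real"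
    and lam :: real
    and z :: "('n::finite) sos_vars"
  assumes "\<And>i. i \<in> {1..k} \<Longrightarrow> real_polynomial_function (g i)"
    and "\<Omega> = basic_semialgebraic k g" and "compact \<Omega>" and "0 \<in> \<Omega>"
    and "\<And>i. i \<in> {1..m} \<Longrightarrow> real_polynomial_function (h i)"
    and "boundary0 \<Omega> = {x. (\<Prod>i=1..m. h i x) = 0}"
    and "\<And>i. real_polynomial_function (\<lambda>x. f x $ i)"
    and "\<And>i j. real_polynomial_function (\<lambda>x. G x $ i $ j)"
    and "\<And>i j. real_polynomial_function (\<lambda>x. B x $ i $ j)"
    and "f 0 = 0" and "G 0 = 0" and "B 0 = 0"
    and "pos_def_matrix R" and "pos_semidef_matrix \<Sigma>\<epsilon>"
    and "real_polynomial_function q" and "pos_def_on \<Omega> q"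
    and "real_polynomial_function \<phi>" and "pos_def_on \<Omega> \<phi>"
    and "lam > 0"
    and "\<And>x. \<Sigma> x = B x ** \<Sigma>\<epsilon> ** transpose (B x)"
    and "\<And>x. lam *\<^sub>R (G x ** matrix_inv R ** transpose (G x)) = \<Sigma> x"
    and "real_polynomial_function \<psi>"
    and "\<And>x. x \<in> boundary0 \<Omega> \<Longrightarrow> \<psi> x = exp (- \<phi> x / lam)"
    and "viscosity_dirichlet (hjb_pde lam q f \<Sigma>) \<Omega> (boundary0 \<Omega>) (\<lambda>x. exp (- \<phi> x / lam)) \<Psi>star"
    and "\<And>\<Phi>. viscosity_dirichlet (hjb_pde lam q f \<Sigma>) \<Omega> (boundary0 \<Omega>) (\<lambda>x. exp (- \<phi> x / lam)) \<Phi>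
           \<Longrightarrow> (\<forall>x\<in>\<Omega>. \<Phi> x = \<Psi>star x)"
    and "sos_solution k g m h lam q f \<Sigma> \<psi> d z"
  shows "\<forall>\<Psi>\<in>{Psi_u z, Psi_l z}. sup_norm_on \<Omega> (\<lambda>x. \<Psi> x - \<Psi>star x) \<le> eps z"
proof -
  let ?l = "Psi_l z" and ?u = "Psi_u z" and ?bd = "boundary0 \<Omega>"
  note \<Omega> = assms(2) and bd0 = assms(6) and b = assms(23)
  have feas: "sos_feasible k g m h lam q f \<Sigma> \<psi> d z"
    using assms(26) by (simp add: sos_solution_def)
  have poly: "real_polynomial_function ?l" "real_polynomial_function ?u"
    using feas by (auto simp: sos_feasible_def intro: poly_deg_le_imp_polynomial)
  have fam: "sos_family d k (S1 z)" "sos_family d k (S2 z)" "sos_family d k (S3 z)"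
    using feas by (auto simp: sos_feasible_def)
  \<comment> \<open>On \<open>\<Omega>\<close> the \<open>D_op\<close> term is nonnegative, so each
    certificate fixes the sign of what remains. For \<open>?l\<close> the sign is then flipped to
    match \<open>hjb_pde\<close>.\<close>
  have "sos (\<lambda>x. - (1/lam) * q x * ?l x + hjb_L f \<Sigma> ?l x - D_op k g (S1 z) x)"
    using feas unfolding sos_feasible_def by blast
  from sos_nonneg[OF this] have l: "(1/lam) * q x * ?l x - hjb_L f \<Sigma> ?l x \<le> 0" if "x \<in> \<Omega>" for x
    using D_op_nonneg[OF fam(1), of x g] that \<Omega> by (smt (verit) mult_minus_left)
  have "sos (\<lambda>x. (1/lam) * q x * ?u x - hjb_L f \<Sigma> ?u x - D_op k g (S2 z) x)"
    using feas unfolding sos_feasible_def by blast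
  from sos_nonneg[OF this] have u: "(1/lam) * q x * ?u x - hjb_L f \<Sigma> ?u x \<ge> 0" if "x \<in> \<Omega>" for x
    using D_op_nonneg[OF fam(2), of x g] that \<Omega> by (smt (verit))
  have "sos (\<lambda>x. eps z - (?u x - ?l x) - D_op k g (S3 z) x)"
    using feas unfolding sos_feasible_def by blast
  from sos_nonneg[OF this] have gap: "?u x - ?l x \<le> eps z" if "x \<in> \<Omega>" for x
    using D_op_nonneg[OF fam(3), of x g] that \<Omega> by (smt (verit))
  have "B_sos m h (\<lambda>x. \<psi> x - ?l x) (T2 z)" "B_sos m h (\<lambda>x. ?u x - \<psi> x) (T3 z)"
    using feas unfolding sos_feasible_def by blast+
  then have \<psi>: "?l x \<le> \<psi> x" "\<psi> x \<le> ?u x" if "x \<in> ?bd" for x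
    using that bd0 B_sos_nonneg[of m h _ _ x] by fastforce+
  \<comment> \<open>Within \<open>\<Omega>\<close>, \<open>q\<close> vanishes only at the origin,
    which \<open>boundary0\<close> includes.\<close>
  have q: "q x > 0" if "x \<in> \<Omega> - ?bd" for x
    using that assms(16) by (auto simp: pos_def_on_def boundary0_def)
  have star: "continuous_on \<Omega> \<Psi>star"
      "viscosity_sub (hjb_pde lam q f \<Sigma>) (\<Omega> - ?bd) \<Psi>star"
      "viscosity_super (hjb_pde lam q f \<Sigma>) (\<Omega> - ?bd) \<Psi>star"
    using assms(24) by (auto simp: viscosity_dirichlet_def)
  \<comment> \<open>On the boundary the polynomial \<open>\<psi>\<close> coincides with the
    exponential Dirichlet data, so the certificates for \<open>\<psi>\<close> bound
    \<open>\<Psi>star\<close> there.\<close>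
  have star_bd: "\<Psi>star x = \<psi> x" if "x \<in> ?bd" for x
    using assms(24) b that by (auto simp: viscosity_dirichlet_def)
  have lower: "?l x \<le> \<Psi>star x" if "x \<in> \<Omega>" for x
    by (rule viscosity_super_comparison[where \<Omega> = \<Omega> and bd = ?bd,
        OF assms(3) star(1) _ _ star(3) assms(19) q _ _ that])
      (use poly l \<psi> star_bd in \<open>auto intro: continuous_on_real_polynomial_function
        C2_on_real_polynomial_function\<close>)
  have upper: "\<Psi>star x \<le> ?u x" if "x \<in> \<Omega>" for x
    by (rule viscosity_sub_comparison[where \<Omega> = \<Omega> and bd = ?bd,
        OF assms(3) star(1) _ _ star(2) assms(19) q _ _ that])
      (use poly u \<psi> star_bd in \<open>auto intro: continuous_on_real_polynomial_function
        C2_on_real_polynomial_function\<close>)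
  \<comment> \<open>\<open>\<Psi>star x\<close> lies in the interval from \<open>?l x\<close> to
    \<open>?u x\<close>, whose length is at most \<open>eps z\<close>; hence both endpoints are that
    close to it.\<close>
  have "\<bar>?u x - \<Psi>star x\<bar> \<le> eps z" "\<bar>?l x - \<Psi>star x\<bar> \<le> eps z" if "x \<in> \<Omega>" for x
    using lower[OF that] upper[OF that] gap[OF that] by auto
  then show ?thesis
    \<comment> \<open>The point 0 makes \<open>\<Omega>\<close> nonempty, as a bound on the supremum
      requires.\<close>
    using assms(4) by (auto simp: sup_norm_on_def intro!: cSUP_least)
qed

end
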